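(* Let $\omega$ be a non-negative measure on $\mathbb{R}$ with bounded, compactly supported density and total mass $m=\omega(\mathbb{R})>0$. Assume that $q_a=q_r=1$ and $m<1$. Let $\mu:[0,\infty)\to\mathcal{P}(\mathbb{R})$ be a transient solution. Then $\mu(t)$ converges to $\omega$ vaguely as $t\to\infty$.
   Context: Vague convergence of finite measures means convergence of integrals against all continuous compactly supported functions. $L^\infty_c(\mathbb{R})$ denotes essentially bounded functions with compact support; $\mathcal{P}(\mathbb{R})$ the probability measures on $\mathbb{R}$; $\mathcal{P}_2(\mathbb{R})$ those with finite second moment. For a finite non-negative measure $\nu$ on $\mathbb{R}$ let $F_\nu(x)=\nu((-\infty,x])$ be its CDF and $X_\nu:[0,\nu(\mathbb{R}))\to\mathbb{R}$, $X_\nu(z)=\inf\{x\in\mathbb{R}:F_\nu(x)>z\}$ its pseudo-inverse. $\mathrm{D}([a,b))$ is the Banach space of bounded functions $[a,b)\to\mathbb{R}$ that are right continuous with a left limit at every point, with the sup-norm. Let $q_a,q_r\in[1,2]$, $\psi_a(x)=|x|^{q_a}$, $\psi_r(x)=|x|^{q_r}$, and put $G=F_\omega$, $Y=X_\omega$. Transient solution: a map $\mu:[0,\infty)\to\mathcal{P}_2(\mathbb{R})$ such that (i) $\mu(t)$ has a density in $L^\infty_c(\mathbb{R})$ for every $t\ge0$; (ii) $t\mapsto X_{\mu(t)}$ is continuously differentiable from $[0,\infty)$ into $\mathrm{D}([0,1))$; (iii) for every $t\ge0$ and $z\in[0,1)$, $$\partial_tX_{\mu(t)}(z)=-A(t,z)+R(t,z),$$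 where $A(t,z)=\int_0^m\psi_a'(X_{\mu(t)}(z)-Y(\zeta))\,d\zeta$ if $q_a>1$ and $A(t,z)=2G(X_{\mu(t)}(z))-m$ if $q_a=1$; and $R(t,z)=\int_0^1\psi_r'(X_{\mu(t)}(z)-X_{\mu(t)}(\zeta))\,d\zeta$ if $q_r>1$ and $R(t,z)=2z-1$ if $q_r=1$. *)

theory Defs
  imports "HOL-Probability.Probability"
begin

text \<open>
  Finite non-negative measures on the real line are modelled as Borel measures; their distribution
  function is the library's \<^const>\<open>cdf\<close>.
\<close>

definition P2 :: "real measure set" where
  "P2 = {M. real_distribution M \<and> integrable M (\<lambda>x. x\<^sup>2)}"

text \<open>
  The condition on the density is the membership in the space of essentially bounded functions with
  compact (essential) support, hence everything is up to Lebesgue null sets.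
\<close>

definition has_bounded_compact_density :: "real measure \<Rightarrow> bool" where
  "has_bounded_compact_density M \<longleftrightarrow>
     (\<exists>f :: real \<Rightarrow> real. f \<in> borel_measurable borel
        \<and> (AE x in lborel. 0 \<le> f x)
        \<and> (\<exists>C. AE x in lborel. \<bar>f x\<bar> \<le> C)
        \<and> (\<exists>K. compact K \<and> (AE x in lborel. x \<notin> K \<longrightarrow> f x = 0))
        \<and> M = density lborel (\<lambda>x. ennreal (f x)))"

text \<open>
  Only the values for \<open>0 \<le> z < measure M UNIV\<close> are meaningful. At \<open>z = 0\<close> the infimum is
  a genuine one if the support of \<open>M\<close> is bounded from below, as is the case for measures
  with a compactly supported density.
\<close>

definition pseudo_inverse :: "real measure \<Rightarrow> real \<Rightarrow> real" where
  "pseudo_inverse M z = Inf {x. z < cdf M x}"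

text \<open>
  The space \<open>D([a,b))\<close> and its norm. Functions are total in HOL; neither notion depends
  on the values outside \<open>[a,b)\<close>.
\<close>

definition D_space :: "real \<Rightarrow> real \<Rightarrow> (real \<Rightarrow> real) set" where
  "D_space a b = {f. bounded (f ` {a..<b})
     \<and> (\<forall>z\<in>{a..<b}. continuous (at_right z) f)
     \<and> (\<forall>z\<in>{a<..<b}. \<exists>l. (f \<longlongrightarrow> l) (at_left z))}"

definition D_norm :: "real \<Rightarrow> real \<Rightarrow> (real \<Rightarrow> real) \<Rightarrow> real" where
  "D_norm a b f = (SUP z\<in>{a..<b}. \<bar>f z\<bar>)"

text \<open>
  Continuously (Frechet) differentiable curves \<open>[0,\<infinity>) \<rightarrow> D([a,b))\<close>, one-sided at time \<open>0\<close>: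
  \<open>V t\<close> is the derivative of \<open>X\<close> at \<open>t\<close>, and all limits are with respect to the norm of \<open>D([a,b))\<close>.
\<close>

definition C1_into_D :: "real \<Rightarrow> real \<Rightarrow> (real \<Rightarrow> real \<Rightarrow> real) \<Rightarrow> bool" where
  "C1_into_D a b X \<longleftrightarrow>
     (\<forall>t\<ge>0. X t \<in> D_space a b) \<and>
     (\<exists>V. (\<forall>t\<ge>0. V t \<in> D_space a b) \<and>
        (\<forall>t\<ge>0. ((\<lambda>s. D_norm a b (\<lambda>z. (X s z - X t z) / (s - t) - V t z)) \<longlongrightarrow> 0)
                  (at t within {0..})) \<and>
        (\<forall>t\<ge>0. ((\<lambda>s. D_norm a b (\<lambda>z. V s z - V t z)) \<longlongrightarrow> 0) (at t within {0..})))"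

definition psi :: "real \<Rightarrow> real \<Rightarrow> real" where
  "psi q x = \<bar>x\<bar> powr q"

definition attraction :: "real \<Rightarrow> real measure \<Rightarrow> (real \<Rightarrow> real measure) \<Rightarrow> real \<Rightarrow> real \<Rightarrow> real" where
  "attraction qa \<omega> \<mu> t z =
     (if qa = 1 then 2 * cdf \<omega> (pseudo_inverse (\<mu> t) z) - measure \<omega> UNIV
      else LINT \<zeta>:{0..<measure \<omega> UNIV}|lborel.
             deriv (psi qa) (pseudo_inverse (\<mu> t) z - pseudo_inverse \<omega> \<zeta>))"

definition repulsion :: "real \<Rightarrow> (real \<Rightarrow> real measure) \<Rightarrow> real \<Rightarrow> real \<Rightarrow> real" where
  "repulsion qr \<mu> t z =
     (if qr = 1 then 2 * z - 1
      else LINT \<zeta>:{0..<1}|lborel.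
             deriv (psi qr) (pseudo_inverse (\<mu> t) z - pseudo_inverse (\<mu> t) \<zeta>))"

text \<open>A curve on \<open>[0,\<infinity>)\<close> is a total function of which only the values at \<open>t \<ge> 0\<close> matter.\<close>

definition transient_solution ::
    "real \<Rightarrow> real \<Rightarrow> real measure \<Rightarrow> (real \<Rightarrow> real measure) \<Rightarrow> bool" where
  "transient_solution qa qr \<omega> \<mu> \<longleftrightarrow>
     (\<forall>t\<ge>0. \<mu> t \<in> P2 \<and> has_bounded_compact_density (\<mu> t)) \<and>
     C1_into_D 0 1 (\<lambda>t. pseudo_inverse (\<mu> t)) \<and>
     (\<forall>t\<ge>0. \<forall>z\<in>{0..<1}.
        ((\<lambda>s. pseudo_inverse (\<mu> s) z) has_real_derivative
           - attraction qa \<omega> \<mu> t z + repulsion qr \<mu> t z) (at t within {0..}))"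

definition vague_convergence :: "('a \<Rightarrow> real measure) \<Rightarrow> real measure \<Rightarrow> 'a filter \<Rightarrow> bool" where
  "vague_convergence \<mu> \<nu> F \<longleftrightarrow>
     (\<forall>f :: real \<Rightarrow> real. continuous_on UNIV f \<and> compact (closure {x. f x \<noteq> 0}) \<longrightarrow>
        ((\<lambda>t. integral\<^sup>L (\<mu> t) f) \<longlongrightarrow> integral\<^sup>L \<nu> f) F)"

end

theory Submission
  imports Defs
begin

text \<open>
  For \<open>q\<^sub>a = q\<^sub>r = 1\<close> the equation decouples: for each \<open>z\<close> the function \<open>x(t) = X t z\<close> solves the scalar
  equation \<open>x' = 2 (u - G x)\<close> with \<open>u = z - (1 - m) / 2\<close>. As \<open>G\<close> is nondecreasing, \<open>x\<close> tends to
  \<open>-\<infinity>\<close> for \<open>u < 0\<close>, to \<open>+\<infinity>\<close> for \<open>u > m\<close>, and for all but countably many \<open>u\<close> in \<open>(0, m)\<close> to \<open>Y u\<close>.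
  Since every finite measure is the push-forward of the Lebesgue measure on \<open>(0, mass)\<close> under its
  pseudo-inverse, dominated convergence yields the integrals against compactly supported functions.
\<close>

section \<open>Barriers for scalar differential inequalities\<close>

text \<open>Above \<open>b\<close> the function descends at rate at least \<open>c\<close>, so it
  reaches \<open>b\<close> in finite time. It cannot exceed \<open>b\<close> later: after its last
  time at or below \<open>b\<close> it would have to climb through a region where it
  descends.\<close>

lemma eventually_le_of_deriv_le:
  fixes x x' :: "real \<Rightarrow> real"
  assumes deriv: "\<And>t. t \<ge> 0 \<Longrightarrow> (x has_real_derivative x' t) (at t within {0..})"
    and "c > 0"
    and decr: "\<And>t. t \<ge> 0 \<Longrightarrow> x t \<ge> b \<Longrightarrow> x' t \<le> - c"
  shows "eventually (\<lambda>t. x t \<le> b) at_top"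
proof -
  have mvt: "\<exists>\<xi>\<in>{s<..<t}. x t - x s = x' \<xi> * (t - s)" if "0 \<le> s" "s < t" for s t
  proof -
    have "(x has_derivative (*) (x' \<xi>)) (at \<xi> within {s..t})" if "s \<le> \<xi>" "\<xi> \<le> t" for \<xi>
      using deriv[of \<xi>] that \<open>0 \<le> s\<close>
      by (auto simp: has_field_derivative_def intro: has_derivative_subset)
    then show ?thesis
      using mvt_simple[OF \<open>s < t\<close>, of x "\<lambda>\<xi>. (*) (x' \<xi>)"] by simp
  qed
  \<comment> \<open>The lower bound is asked only on the open interval, so that \<open>s\<close> may
    itself be a time with \<open>x s \<le> b\<close>.\<close>
  have drop: "x t \<le> x s - c * (t - s)"
    if st: "0 \<le> s" "s < t" and above: "\<And>\<xi>. s < \<xi> \<Longrightarrow> \<xi> < t \<Longrightarrow> x \<xi> \<ge> b" for s t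
  proof -
    obtain \<xi> where \<xi>: "s < \<xi>" "\<xi> < t" "x t - x s = x' \<xi> * (t - s)"
      using mvt[OF st] by auto
    then have "x' \<xi> * (t - s) \<le> - c * (t - s)"
      using decr[of \<xi>] st above[of \<xi>] by (intro mult_right_mono) auto
    with \<xi> show ?thesis by simp
  qed
  have "\<exists>t0\<ge>0. x t0 \<le> b"
  proof (rule ccontr)
    assume "\<not> ?thesis"
    then have above: "\<And>t. t \<ge> 0 \<Longrightarrow> x t > b" by force
    \<comment> \<open>By this time a descent from \<open>x 0\<close> at rate \<open>c\<close> has
      arrived at \<open>b\<close>.\<close>
    define t where "t = (x 0 - b) / c"
    have "t > 0" using above[of 0] \<open>c > 0\<close> by (simp add: t_def)
    then have "x t \<le> x 0 - c * (t - 0)"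
      using above by (intro drop) (auto intro: less_imp_le)
    also have "\<dots> = b" using \<open>c > 0\<close> by (simp add: t_def)
    finally show False using above[of t] \<open>t > 0\<close> by simp
  qed
  then obtain t0 where t0: "t0 \<ge> 0" "x t0 \<le> b" by blast
  have "x t \<le> b" if "t \<ge> t0" for t
  proof (rule ccontr)
    assume "\<not> x t \<le> b"
    have cont: "continuous_on {t0..t} x"
      using t0(1) by (intro DERIV_continuous_on[where D = x'])
        (auto intro: DERIV_subset[OF deriv])
    \<comment> \<open>The last time up to \<open>t\<close> at or below \<open>b\<close>; continuity
      makes the set closed, so the supremum is attained.\<close>
    define s where "s = Sup {s \<in> {t0..t}. x s \<le> b}"
    have "closed ({t0..t} \<inter> x -` {..b})"
      by (intro continuous_closed_preimage cont) auto
    also have "{t0..t} \<inter> x -` {..b} = {s \<in> {t0..t}. x s \<le> b}" by auto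
    finally have s_in: "s \<in> {s \<in> {t0..t}. x s \<le> b}"
      unfolding s_def using t0 that
      by (intro closed_contains_Sup) (auto intro!: bdd_aboveI[of _ t])
    have "x \<xi> > b" if "s < \<xi>" "\<xi> < t" for \<xi>
    proof (rule ccontr)
      assume "\<not> x \<xi> > b"
      then have "\<xi> \<le> s"
        unfolding s_def using that s_in by (intro cSup_upper bdd_aboveI[of _ t]) auto
      with that show False by simp
    qed
    moreover have "s < t"
      using s_in \<open>\<not> x t \<le> b\<close> by (cases "s = t") auto
    ultimately have "x t \<le> x s - c * (t - s)"
      using s_in t0(1) by (intro drop) (auto intro: less_imp_le)
    also have "\<dots> \<le> x s" using \<open>c > 0\<close> \<open>s < t\<close> by simp
    finally show False using s_in \<open>\<not> x t \<le> b\<close> by simp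
  qed
  then show ?thesis
    unfolding eventually_at_top_linorder by blast
qed

lemma eventually_ge_of_deriv_ge:
  fixes x x' :: "real \<Rightarrow> real"
  assumes deriv: "\<And>t. t \<ge> 0 \<Longrightarrow> (x has_real_derivative x' t) (at t within {0..})"
    and "c > 0"
    and incr: "\<And>t. t \<ge> 0 \<Longrightarrow> x t \<le> b \<Longrightarrow> x' t \<ge> c"
  shows "eventually (\<lambda>t. x t \<ge> b) at_top"
proof -
  have "eventually (\<lambda>t. - x t \<le> - b) at_top"
    by (rule eventually_le_of_deriv_le[where x' = "\<lambda>t. - x' t" and c = c])
      (use assms in \<open>auto intro: DERIV_minus\<close>)
  then show ?thesis by simp
qed

section \<open>The pseudo-inverse as quantile transform\<close>

context finite_borel_measure
begin

lemma cdf_superlevel_nonempty: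
  assumes "z < measure M UNIV"
  shows "\<exists>x. z < cdf M x"
proof -
  have "eventually (\<lambda>x. z < cdf M x) at_top"
    using order_tendstoD(1)[OF cdf_lim_at_top] assms by (simp add: borel_UNIV)
  then show ?thesis by (auto simp: eventually_at_top_linorder)
qed

text \<open>The distribution function tends to \<open>0\<close> at minus infinity. This makes the
  infimum in \<open>pseudo_inverse\<close> genuine; at \<open>z = 0\<close> it can fail, hence the
  open interval of labels below.\<close>

lemma cdf_superlevel_bdd_below:
  assumes "0 < z"
  shows "bdd_below {x. z < cdf M x}"
proof -
  have "eventually (\<lambda>x. cdf M x < z) at_bot"
    using order_tendstoD(2)[OF cdf_lim_at_bot assms] .
  then obtain a where "\<And>x. x \<le> a \<Longrightarrow> cdf M x < z"
    by (auto simp: eventually_at_bot_linorder)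
  then show ?thesis by (intro bdd_belowI[of _ a]) (metis less_asym linear mem_Collect_eq)
qed

lemma pseudo_inverse_le:
  assumes "0 < z" "z < cdf M x"
  shows "pseudo_inverse M z \<le> x"
  unfolding pseudo_inverse_def
  using assms cdf_superlevel_bdd_below by (intro cInf_lower) auto

lemma cdf_gt_if_pseudo_inverse_less:
  assumes "z < measure M UNIV" "pseudo_inverse M z < x"
  shows "z < cdf M x"
proof -
  obtain y where "z < cdf M y" "y < x"
    using assms cdf_superlevel_nonempty cInf_lessD[of "{x. z < cdf M x}" x]
    unfolding pseudo_inverse_def by auto
  then show ?thesis using cdf_nondecreasing[of y x] by linarith
qed

text \<open>Right continuity keeps \<open>cdf M\<close> below \<open>z\<close> slightly beyond
  \<open>x\<close>, which gives the strict inequality.\<close>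

lemma pseudo_inverse_greater:
  assumes "z < measure M UNIV" "cdf M x < z"
  shows "x < pseudo_inverse M z"
proof -
  have "eventually (\<lambda>y. cdf M y < z) (at_right x)"
    using cdf_is_right_cont[of x] assms(2) by (auto simp: continuous_within intro: order_tendstoD)
  then obtain y where "x < y" "cdf M y < z"
    by (metis eventually_at_right_field dense)
  then show ?thesis
    using cdf_gt_if_pseudo_inverse_less[OF assms(1), of y] by force
qed

lemma mono_on_pseudo_inverse: "mono_on {0<..<measure M UNIV} (pseudo_inverse M)"
proof (rule mono_onI)
  fix y z assume "y \<in> {0<..<measure M UNIV}" "z \<in> {0<..<measure M UNIV}" "y \<le> z"
  then show "pseudo_inverse M y \<le> pseudo_inverse M z"
    unfolding pseudo_inverse_def
    using cdf_superlevel_nonempty[of z] cdf_superlevel_bdd_below[of y]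
    by (intro cInf_superset_mono) auto
qed

lemma pseudo_inverse_measurable:
  "pseudo_inverse M \<in> borel_measurable (restrict_space lborel {0<..<measure M UNIV})"
  using borel_measurable_mono_on_fnc[OF mono_on_pseudo_inverse]
  by (simp cong: measurable_cong_sets add: sets_restrict_space)

text \<open>Finite Borel measures are determined by the rays \<open>{x<..}\<close>. The labels sent
  into such a ray fill, up to the endpoint \<open>cdf M x\<close>, the interval from
  \<open>cdf M x\<close> to the total mass, and its length is the mass of the ray.\<close>

lemma distr_pseudo_inverse:
  "distr (restrict_space lborel {0<..<measure M UNIV}) borel (pseudo_inverse M) = M"
  (is "distr ?L borel ?X = M")
proof (rule measure_eqI_lessThan)
  let ?m = "measure M UNIV"
  have meas: "?X \<in> borel_measurable ?L"
    by (rule pseudo_inverse_measurable)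
  show "sets M = sets borel" by (rule M_is_borel)
  fix x
  define S where "S = ?X -` {x<..} \<inter> {0<..<?m}"
  have "S \<in> sets ?L"
    using measurable_sets[OF meas, of "{x<..}"] by (simp add: S_def space_restrict_space)
  then have S: "S \<in> sets lborel"
    by (simp add: sets_restrict_space_iff)
  have F: "0 \<le> cdf M x" "cdf M x \<le> ?m"
    using cdf_nonneg cdf_bounded[of x] by (auto simp: borel_UNIV)
  have "emeasure lborel {cdf M x<..<?m} \<le> emeasure lborel S"
    using S F by (intro emeasure_mono) (auto simp: S_def intro: pseudo_inverse_greater)
  moreover have "S \<subseteq> {cdf M x..<?m}"
    using pseudo_inverse_le[of _ x] by (force simp: S_def not_le[symmetric])
  then have "emeasure lborel S \<le> emeasure lborel {cdf M x..<?m}"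
    by (intro emeasure_mono) auto
  ultimately have "emeasure lborel S = ennreal (?m - cdf M x)"
    using F by simp
  also have "{x<..} = UNIV - {..x}" by auto
  then have "?m - cdf M x = measure M {x<..}"
    using finite_measure_compl[of "{..x}"] by (simp add: cdf_def borel_UNIV sets_M)
  finally have "emeasure lborel S = emeasure M {x<..}"
    by (simp add: emeasure_eq_measure)
  moreover have "emeasure (distr ?L borel ?X) {x<..} = emeasure lborel S"
    using meas S
    by (simp add: emeasure_distr S_def space_restrict_space emeasure_restrict_space)
  ultimately show "emeasure (distr ?L borel ?X) {x<..} = emeasure M {x<..}" by simp
  then show "emeasure (distr ?L borel ?X) {x<..} < \<infinity>"
    by (simp add: emeasure_eq_measure)
qed simp

lemma integral_pseudo_inverse:
  fixes f :: "real \<Rightarrow> real"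
  assumes [measurable]: "f \<in> borel_measurable borel"
  shows "integral\<^sup>L M f = (LINT z:{0<..<measure M UNIV}|lborel. f (pseudo_inverse M z))"
proof -
  have "integral\<^sup>L M f = (LINT z|restrict_space lborel {0<..<measure M UNIV}. f (pseudo_inverse M z))"
    by (subst distr_pseudo_inverse[symmetric], rule integral_distr)
      (auto intro: pseudo_inverse_measurable)
  then show ?thesis
    by (simp add: integral_restrict_space set_lebesgue_integral_def)
qed

lemma set_borel_measurable_pseudo_inverse:
  fixes f :: "real \<Rightarrow> real"
  assumes [measurable]: "f \<in> borel_measurable borel"
  shows "set_borel_measurable lborel {0<..<measure M UNIV} (\<lambda>z. f (pseudo_inverse M z))"
proof -
  have "(\<lambda>z. f (pseudo_inverse M z)) \<in> borel_measurable (restrict_space lborel {0<..<measure M UNIV})"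
    using pseudo_inverse_measurable by measurable
  then show ?thesis
    by (simp add: set_borel_measurable_def borel_measurable_restrict_space_iff)
qed

text \<open>A nondegenerate interval on which the distribution function is constant contains a rational.\<close>

lemma cdf_less_if_less_pseudo_inverse:
  assumes "0 < u" "u \<notin> cdf M ` \<rat>" "y < pseudo_inverse M u"
  shows "cdf M y < u"
proof (rule ccontr)
  assume "\<not> cdf M y < u"
  obtain q where q: "q \<in> \<rat>" "y < q" "q < pseudo_inverse M u"
    using Rats_dense_in_real[OF assms(3)] by blast
  have "cdf M q \<le> u"
    using pseudo_inverse_le[OF assms(1), of q] q(3) by force
  moreover have "u \<le> cdf M q"
    using \<open>\<not> cdf M y < u\<close> cdf_nondecreasing[of y q] q(2) by simp
  ultimately have "cdf M q = u" by simp
  then show False using assms(2) q(1) by blast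
qed

end

section \<open>Test functions and the scalar equation\<close>

lemma bounded_compact_support:
  fixes f :: "real \<Rightarrow> real"
  assumes "continuous_on UNIV f" "compact (closure {x. f x \<noteq> 0})"
  obtains B C where "\<And>x. \<bar>f x\<bar> \<le> C" "\<And>x. \<bar>x\<bar> > B \<Longrightarrow> f x = 0"
proof -
  let ?K = "closure {x. f x \<noteq> 0}"
  have "bounded (f ` ?K)"
    using assms by (intro compact_imp_bounded compact_continuous_image)
      (auto intro: continuous_on_subset)
  then obtain C where C: "\<And>x. x \<in> ?K \<Longrightarrow> \<bar>f x\<bar> \<le> C"
    by (auto simp: bounded_iff)
  obtain B where B: "\<And>x. x \<in> ?K \<Longrightarrow> \<bar>x\<bar> \<le> B"
    using compact_imp_bounded[OF assms(2)] by (auto simp: bounded_iff)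
  have K: "x \<in> ?K" if "f x \<noteq> 0" for x
    using that closure_subset[of "{x. f x \<noteq> 0}"] by auto
  show ?thesis
  proof
    \<comment> \<open>\<open>C\<close> bounds \<open>f\<close> only on the support and may be
      negative if the support is empty.\<close>
    show "\<bar>f x\<bar> \<le> max C 0" for x
      using C[of x] K[of x] by (cases "f x = 0") auto
    show "f x = 0" if "\<bar>x\<bar> > B" for x
      using B[of x] K[of x] that by force
  qed
qed

text \<open>To the right of \<open>b\<close> monotonicity gives \<open>g (x t) \<ge> g b\<close>, so
  the velocity is at most the negative constant \<open>- 2 * (g b - u)\<close>.\<close>

lemma eventually_le_monotone_ode:
  fixes x g :: "real \<Rightarrow> real"
  assumes "\<And>t. t \<ge> 0 \<Longrightarrow> (x has_real_derivative 2 * (u - g (x t))) (at t within {0..})"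
    and "mono g" "u < g b"
  shows "eventually (\<lambda>t. x t \<le> b) at_top"
  by (rule eventually_le_of_deriv_le[OF assms(1), of "2 * (g b - u)"])
    (use assms(3) in \<open>auto dest: monoD[OF assms(2)]\<close>)

lemma eventually_ge_monotone_ode:
  fixes x g :: "real \<Rightarrow> real"
  assumes "\<And>t. t \<ge> 0 \<Longrightarrow> (x has_real_derivative 2 * (u - g (x t))) (at t within {0..})"
    and "mono g" "g b < u"
  shows "eventually (\<lambda>t. x t \<ge> b) at_top"
  by (rule eventually_ge_of_deriv_ge[OF assms(1), of "2 * (u - g b)"])
    (use assms(3) in \<open>auto dest: monoD[OF assms(2)]\<close>)

section \<open>Escape and trapping of labels, and passage to the limit\<close>

theorem theorem4p6:
  fixes \<omega> :: "real measure" and \<mu> :: "real \<Rightarrow> real measure" and qa qr m :: real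
  assumes "has_bounded_compact_density \<omega>"
    and "m = measure \<omega> UNIV" and "0 < m"
    and "qa = 1" and "qr = 1" and "m < 1"
    and "transient_solution qa qr \<omega> \<mu>"
  shows "vague_convergence \<mu> \<omega> at_top"
proof -
  have sets_\<omega>: "sets \<omega> = sets borel"
    using assms(1) by (auto simp: has_bounded_compact_density_def)
  then have "space \<omega> = UNIV" by (simp add: sets_eq_imp_space_eq)
  \<comment> \<open>\<open>measure\<close> takes the value \<open>0\<close> on sets of infinite
    measure, so \<open>0 < m\<close> excludes that case.\<close>
  moreover have "emeasure \<omega> UNIV \<noteq> \<infinity>"
    using assms(2,3) by (auto simp: measure_def)
  ultimately interpret finite_borel_measure \<omega>
    by (intro finite_borel_measure.intro finite_borel_measure_axioms.intro finite_measureI)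
      (simp_all add: sets_\<omega>)
  have G: "mono (cdf \<omega>)" by (auto intro: monoI cdf_nondecreasing)
  have G_range: "0 \<le> cdf \<omega> x" "cdf \<omega> x \<le> m" for x
    using cdf_nonneg cdf_bounded[of x] by (auto simp: assms(2) borel_UNIV)
  define X where "X t = pseudo_inverse (\<mu> t)" for t
  define Y where "Y = pseudo_inverse \<omega>"
  \<comment> \<open>Half of the excess mass: labels below \<open>s\<close> escape to the left,
    labels above \<open>s + m = 1 - s\<close> to the right.\<close>
  define s where "s = (1 - m) / 2"
  have \<mu>: "real_distribution (\<mu> t)" if "t \<ge> 0" for t
    using assms(7) that by (auto simp: transient_solution_def P2_def)
  have ode: "((\<lambda>t. X t z) has_real_derivative 2 * ((z - s) - cdf \<omega> (X t z))) (at t within {0..})"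
    if "t \<ge> 0" "z \<in> {0<..<1}" for t z
  proof -
    have "((\<lambda>t. X t z) has_real_derivative - attraction qa \<omega> \<mu> t z + repulsion qr \<mu> t z)
        (at t within {0..})"
      using assms(7) that by (auto simp: transient_solution_def X_def)
    also have "- attraction qa \<omega> \<mu> t z + repulsion qr \<mu> t z = 2 * ((z - s) - cdf \<omega> (X t z))"
      by (simp add: attraction_def repulsion_def assms(4,5) X_def s_def field_simps
          flip: assms(2))
    finally show ?thesis .
  qed
  show ?thesis
    unfolding vague_convergence_def
  proof (intro allI impI, elim conjE)
    fix f :: "real \<Rightarrow> real"
    assume f: "continuous_on UNIV f" "compact (closure {x. f x \<noteq> 0})"
    obtain B C where C: "\<And>x. \<bar>f x\<bar> \<le> C" and B: "\<And>x. \<bar>x\<bar> > B \<Longrightarrow> f x = 0"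
      by (rule bounded_compact_support[OF f]) blast
    have f_meas [measurable]: "f \<in> borel_measurable borel"
      using f(1) by (rule borel_measurable_continuous_onI)
    let ?h = "\<lambda>u. indicator {0<..<m} u * f (Y u)"
    let ?k = "\<lambda>t z. indicator {0<..<1} z * f (X t z)"
    have int_\<mu>: "integral\<^sup>L (\<mu> t) f = (LINT z|lborel. ?k t z)"
      and k_meas: "?k t \<in> borel_measurable lborel" if "t \<ge> 0" for t
    proof -
      interpret D: real_distribution "\<mu> t" by (rule \<mu>[OF that])
      have "measure (\<mu> t) UNIV = 1" using D.prob_space by simp
      then show "integral\<^sup>L (\<mu> t) f = (LINT z|lborel. ?k t z)" "?k t \<in> borel_measurable lborel"
        using D.integral_pseudo_inverse[OF f_meas] D.set_borel_measurable_pseudo_inverse[OF f_meas]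
        by (simp_all add: set_lebesgue_integral_def set_borel_measurable_def X_def)
    qed
    have h_meas [measurable]: "?h \<in> borel_measurable borel"
      using set_borel_measurable_pseudo_inverse[OF f_meas]
      by (simp add: set_borel_measurable_def Y_def assms(2))
    have "integral\<^sup>L \<omega> f = (LINT u|lborel. ?h u)"
      using integral_pseudo_inverse[OF f_meas]
      by (simp add: set_lebesgue_integral_def Y_def assms(2))
    \<comment> \<open>The shift places the labels of \<open>\<omega>\<close> at the labels in
      \<open>(s, s + m)\<close> that are trapped.\<close>
    also have "\<dots> = (LINT z|lborel. ?h (z - s))"
      using lborel_integral_real_affine[of 1 ?h "- s"] by simp
    finally have int_\<omega>: "integral\<^sup>L \<omega> f = (LINT z|lborel. ?h (z - s))" .

    \<comment> \<open>The values \<open>0\<close> and \<open>m\<close> are the thresholds of escape.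
      The values at rationals include every level at which \<open>cdf \<omega>\<close> is flat on an
      interval, where the limit can depend on the initial position.\<close>
    have lim: "((\<lambda>t. ?k t z) \<longlongrightarrow> ?h (z - s)) at_top"
      if z: "z - s \<notin> cdf \<omega> ` \<rat> \<union> {0, m}" for z
    proof (cases "z \<in> {0<..<1}")
      case False
      \<comment> \<open>From \<open>m < 1\<close> follows \<open>s > 0\<close>, so the trapped
        labels lie inside the unit interval.\<close>
      then have "z - s \<notin> {0<..<m}"
        using assms(6) by (auto simp: s_def field_simps)
      with False show ?thesis by simp
    next
      case True
      note le = eventually_le_monotone_ode[OF ode[OF _ True] G]
      note ge = eventually_ge_monotone_ode[OF ode[OF _ True] G]
      consider "z - s < 0" | "z - s > m" | "0 < z - s" "z - s < m" using z by fastforce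
      then show ?thesis
      proof cases
        case 1
        \<comment> \<open>Here \<open>z - s < 0 \<le> cdf \<omega> (- B - 1)\<close>, so the
          trajectory ends up left of the support of \<open>f\<close>.\<close>
        then have "eventually (\<lambda>t. X t z \<le> - B - 1) at_top"
          using G_range(1)[of "- B - 1"] by (intro le) linarith+
        then have "eventually (\<lambda>t. ?k t z = 0) at_top"
          by eventually_elim (auto intro: B)
        then show ?thesis using 1 by (simp add: tendsto_eventually)
      next
        case 2
        then have "eventually (\<lambda>t. X t z \<ge> B + 1) at_top"
          using G_range(2)[of "B + 1"] by (intro ge) linarith+
        then have "eventually (\<lambda>t. ?k t z = 0) at_top"
          by eventually_elim (auto intro: B)
        then show ?thesis using 2 by (simp add: tendsto_eventually)
      next
        case 3
        \<comment> \<open>Every point on either side of \<open>Y (z - s)\<close> is a barrier: on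
          the left because \<open>z - s\<close> is no flat level, on the right by definition of the
          infimum.\<close>
        have "((\<lambda>t. X t z) \<longlongrightarrow> Y (z - s)) at_top"
        proof (rule order_tendstoI)
          fix a assume "a < Y (z - s)"
          then obtain b where b: "a < b" "b < Y (z - s)" using dense by blast
          then have "eventually (\<lambda>t. X t z \<ge> b) at_top"
            using z 3 by (intro ge cdf_less_if_less_pseudo_inverse) (auto simp: Y_def)
          then show "eventually (\<lambda>t. a < X t z) at_top"
            by eventually_elim (use b in auto)
        next
          fix a assume "Y (z - s) < a"
          then obtain b where b: "Y (z - s) < b" "b < a" using dense by blast
          then have "eventually (\<lambda>t. X t z \<le> b) at_top"
            using 3 by (intro le cdf_gt_if_pseudo_inverse_less) (auto simp: Y_def assms(2))
          then show "eventually (\<lambda>t. X t z < a) at_top"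
            by eventually_elim (use b in auto)
        qed
        then have "((\<lambda>t. f (X t z)) \<longlongrightarrow> f (Y (z - s))) at_top"
          using f(1) by (intro isCont_tendsto_compose[of _ f])
            (auto simp: continuous_on_eq_continuous_at)
        then show ?thesis using True 3 by simp
      qed
    qed
    \<comment> \<open>One exceptional set of labels serves all times; it is null because the
      rationals are countable.\<close>
    have "countable ((+) s ` (cdf \<omega> ` \<rat> \<union> {0, m}))"
      by (intro countable_image countable_Un countable_rat) auto
    then have "AE z in lborel. z \<notin> (+) s ` (cdf \<omega> ` \<rat> \<union> {0, m})"
      by (intro AE_not_in countable_imp_null_set_lborel)
    then have AE_lim: "AE z in lborel. ((\<lambda>t. ?k t z) \<longlongrightarrow> ?h (z - s)) at_top"
    proof eventually_elim
      case (elim z)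
      have "z - s \<notin> cdf \<omega> ` \<rat> \<union> {0, m}"
      proof
        assume "z - s \<in> cdf \<omega> ` \<rat> \<union> {0, m}"
        then have "s + (z - s) \<in> (+) s ` (cdf \<omega> ` \<rat> \<union> {0, m})" by (rule imageI)
        with elim show False by simp
      qed
      then show ?case by (rule lim)
    qed
    \<comment> \<open>\<open>\<mu> t\<close> is arbitrary for \<open>t < 0\<close>, where dominated convergence still asks for measurability.\<close>
    have "((\<lambda>t. LINT z|lborel. ?k (max t 0) z) \<longlongrightarrow> (LINT z|lborel. ?h (z - s))) at_top"
    proof (rule integral_dominated_convergence_at_top[where w = "\<lambda>z. C * indicator {0<..<1} z"])
      show "AE z in lborel. ((\<lambda>t. ?k (max t 0) z) \<longlongrightarrow> ?h (z - s)) at_top"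
        using AE_lim
      proof eventually_elim
        case (elim z)
        show ?case
          by (rule Lim_transform_eventually[OF elim])
            (use eventually_ge_at_top[of 0] in eventually_elim, simp)
      qed
      show "\<forall>\<^sub>F t in at_top. AE z in lborel. norm (?k (max t 0) z) \<le> C * indicator {0<..<1} z"
        using C by (intro always_eventually allI AE_I2) (auto split: split_indicator)
    qed (use k_meas in auto)
    then show "((\<lambda>t. integral\<^sup>L (\<mu> t) f) \<longlongrightarrow> integral\<^sup>L \<omega> f) at_top"
      unfolding int_\<omega>
      by (rule Lim_transform_eventually)
        (use eventually_ge_at_top[of 0] in eventually_elim, simp add: int_\<mu>)
  qed
qed

end
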